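(* Let $\epsilon>0$ and $x_0\in\mathbb{R}^d$. For all $y_0\in M$ with $\delta_\epsilon(y_0)\le\frac12$ and all $t\in[0,1]$, $$|\hat x_\epsilon(t)-X(t)|\le 5e^{2L}\bigl(\delta_\epsilon(y_0)+\epsilon\bigr).$$
   Context: Let $T:M\to M$ be a transformation of a measurable space $M$ (no metric structure on $M$ is assumed), and suppose that $a:\mathbb{R}^d\times M\to\mathbb{R}^d$ and $\bar a:\mathbb{R}^d\to\mathbb{R}^d$ are functions. Write $D=\frac{d}{dx}$. For $g:\mathbb{R}^d\to\mathbb{R}^n$ let $\|g\|_{\mathrm{Lip}}=\max\{|g|_\infty,\mathrm{Lip}\,g\}$, where $\mathrm{Lip}\,g=\sup_{x\ne x'}|g(x)-g(x')|/|x-x'|$ and $|x-x'|=\max_i|x_i-x'_i|$; for $g:\mathbb{R}^d\times M\to\mathbb{R}^n$ let $\|g\|_{\mathrm{Lip}}=\sup_{y\in M}\|g(\cdot,y)\|_{\mathrm{Lip}}$. For the matrix-valued function $Da:\mathbb{R}^d\times M\to\mathbb{R}^{d\times d}$, $\|Da\|_{\mathrm{Lip}}$ is defined accordingly. Assume that $\|a\|_{\mathrm{Lip}}\le L$ and $\|Da\|_{\mathrm{Lip}}\le L$, where $L\ge1$. For $\epsilon>0$, with $x_0\in\mathbb{R}^d$ and $y_0\in M$ given, consider the discrete fast-slow system $x_{n+1}=x_n+\epsilon a(x_n,y_n)$, $y_{n+1}=Ty_n$. Define $\hat x_\epsilon:[0,1]\to\mathbb{R}^d$ by $\hat x_\epsilon(t)=x_{[t/\epsilon]}$,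 where $[\cdot]$ is the integer part, and let $X:[0,1]\to\mathbb{R}^d$ be the solution of the ODE $\dot X=\bar a(X)$ with initial condition $X(0)=x_0$. Define $\delta_\epsilon=\delta_{1,\epsilon}+\delta_{2,\epsilon}$, where $$\delta_{1,\epsilon}(y_0)=\sup_{x}\sup_{1\le n\le1/\epsilon}\epsilon\Bigl|\sum_{j=0}^{n-1}(a(x,y_j)-\bar a(x))\Bigr|,\qquad \delta_{2,\epsilon}(y_0)=\sup_{x}\sup_{1\le n\le1/\epsilon}\epsilon\Bigl|\sum_{j=0}^{n-1}(Da(x,y_j)-D\bar a(x))\Bigr|,$$ the suprema in $x$ being over $\mathbb{R}^d$.
   Formalization: For ε>1 the suprema defining δ_ε are over an empty set (δ_ε=0) and the claim fails for large constant ā; there, and only there, |ā|_∞≤L is additionally assumed. The norm of matrices is the operator norm induced by the max norm. *)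

theory Defs
  imports "HOL-Analysis.Analysis"
begin

text \<open>
  Vectors in \<open>real ^ 'd\<close> are measured by \<open>infnorm\<close>, the maximum norm. Suprema
  of norms of functions and sums are taken in \<open>ennreal\<close>, so that unbounded suprema are \<open>\<infinity>\<close> and
  empty ones are \<open>0\<close>.
\<close>

text \<open>
  The operator norm induced by the maximum norm (the maximal absolute row sum). The
  largest absolute entry would be the wrong norm here: it bounds Lipschitz constants only up
  to a factor \<open>d\<close>, whereas the constants of the averaging estimate are dimension-free.
\<close>

definition mat_infnorm :: "real ^ 'd ^ 'n \<Rightarrow> real" where
  "mat_infnorm A = (SUP v. infnorm (A *v v) / infnorm v)"

text \<open>The parameter \<open>\<nu>\<close> is the norm on the codomain (\<open>infnorm\<close> or \<open>mat_infnorm\<close>).\<close>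

definition sup_norm :: "('b \<Rightarrow> real) \<Rightarrow> (real ^ 'd \<Rightarrow> 'b) \<Rightarrow> ennreal" where
  "sup_norm \<nu> g = (SUP x. ennreal (\<nu> (g x)))"

definition lip_const :: "('b \<Rightarrow> real) \<Rightarrow> (real ^ 'd \<Rightarrow> 'b::minus) \<Rightarrow> ennreal" where
  "lip_const \<nu> g = (SUP (x, x') \<in> {(x, x'). x \<noteq> x'}. ennreal (\<nu> (g x - g x') / infnorm (x - x')))"

definition lip_norm :: "('b \<Rightarrow> real) \<Rightarrow> (real ^ 'd \<Rightarrow> 'b::minus) \<Rightarrow> ennreal" where
  "lip_norm \<nu> g = max (sup_norm \<nu> g) (lip_const \<nu> g)"

definition lip_norm_on ::
    "'m set \<Rightarrow> ('b \<Rightarrow> real) \<Rightarrow> (real ^ 'd \<Rightarrow> 'm \<Rightarrow> 'b::minus) \<Rightarrow> ennreal" where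
  "lip_norm_on S \<nu> g = (SUP y\<in>S. lip_norm \<nu> (\<lambda>x. g x y))"

definition D :: "(real ^ 'd \<Rightarrow> real ^ 'd) \<Rightarrow> real ^ 'd \<Rightarrow> real ^ 'd ^ 'd" where
  "D f x = jacobian f (at x)"

primrec slow ::
    "(real ^ 'd \<Rightarrow> 'm \<Rightarrow> real ^ 'd) \<Rightarrow> ('m \<Rightarrow> 'm) \<Rightarrow> real \<Rightarrow> real ^ 'd \<Rightarrow> 'm \<Rightarrow> nat \<Rightarrow> real ^ 'd" where
  "slow a T \<epsilon> x0 y0 0 = x0"
| "slow a T \<epsilon> x0 y0 (Suc n) =
     slow a T \<epsilon> x0 y0 n + \<epsilon> *\<^sub>R a (slow a T \<epsilon> x0 y0 n) ((T ^^ n) y0)"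

definition xhat ::
    "(real ^ 'd \<Rightarrow> 'm \<Rightarrow> real ^ 'd) \<Rightarrow> ('m \<Rightarrow> 'm) \<Rightarrow> real \<Rightarrow> real ^ 'd \<Rightarrow> 'm \<Rightarrow> real \<Rightarrow> real ^ 'd" where
  "xhat a T \<epsilon> x0 y0 t = slow a T \<epsilon> x0 y0 (nat \<lfloor>t / \<epsilon>\<rfloor>)"

text \<open>
  For \<open>\<epsilon> > 1\<close> the range of \<open>n\<close> is empty, so both suprema below are \<open>0\<close> and do not
  relate \<open>abar\<close> to \<open>a\<close>. A bound on \<open>abar\<close>, automatic when it is an average of \<open>a\<close>,
  has to be assumed separately in that case, and only in that case.
\<close>

definition delta1 ::
    "(real ^ 'd \<Rightarrow> 'm \<Rightarrow> real ^ 'd) \<Rightarrow> (real ^ 'd \<Rightarrow> real ^ 'd) \<Rightarrow> ('m \<Rightarrow> 'm) \<Rightarrow> real \<Rightarrow> 'm \<Rightarrow> ennreal" where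
  "delta1 a abar T \<epsilon> y0 =
     (SUP x. SUP n \<in> {n. 1 \<le> n \<and> real n \<le> 1 / \<epsilon>}.
        ennreal (\<epsilon> * infnorm (\<Sum>j<n. a x ((T ^^ j) y0) - abar x)))"

definition delta2 ::
    "(real ^ 'd \<Rightarrow> 'm \<Rightarrow> real ^ 'd) \<Rightarrow> (real ^ 'd \<Rightarrow> real ^ 'd) \<Rightarrow> ('m \<Rightarrow> 'm) \<Rightarrow> real \<Rightarrow> 'm \<Rightarrow> ennreal" where
  "delta2 a abar T \<epsilon> y0 =
     (SUP x. SUP n \<in> {n. 1 \<le> n \<and> real n \<le> 1 / \<epsilon>}.
        ennreal (\<epsilon> * mat_infnorm (\<Sum>j<n. D (\<lambda>x. a x ((T ^^ j) y0)) x - D abar x)))"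

definition delta ::
    "(real ^ 'd \<Rightarrow> 'm \<Rightarrow> real ^ 'd) \<Rightarrow> (real ^ 'd \<Rightarrow> real ^ 'd) \<Rightarrow> ('m \<Rightarrow> 'm) \<Rightarrow> real \<Rightarrow> 'm \<Rightarrow> ennreal" where
  "delta a abar T \<epsilon> y0 = delta1 a abar T \<epsilon> y0 + delta2 a abar T \<epsilon> y0"

end

theory Submission
  imports Defs
begin

text \<open>
  Write \<open>y\<^sub>j\<close> for the orbit of \<open>y0\<close>, \<open>x\<^sub>n\<close> for the slow variable and
  \<open>u n z\<close> for \<open>\<epsilon>\<close> times the sum over \<open>j < n\<close> of \<open>a z y\<^sub>j - abar z\<close>, the accumulated
  deviation from the average at a frozen point \<open>z\<close>. For \<open>n \<le> 1/\<epsilon>\<close>, \<open>u n\<close> is bounded by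
  \<open>\<delta>1\<close>, and by the mean value theorem it is Lipschitz with constant \<open>\<delta>2\<close>.

  The idea is the near-identity change of variables \<open>x\<^sub>n - u n x\<^sub>n\<close>. At a frozen point, passing
  from \<open>u n\<close> to \<open>u (n+1)\<close> removes exactly the oscillating part of one step, so the new variable
  advances by \<open>\<epsilon> abar x\<^sub>n\<close> up to the change of \<open>u (n+1)\<close> between \<open>x\<^sub>n\<close> and \<open>x\<^sub>n\<^sub>+\<^sub>1\<close>.
  These points have distance at most \<open>\<epsilon> L\<close>, so the error is \<open>\<epsilon> L \<delta>2\<close> per step, hence
  \<open>L \<delta>2\<close> over time one (lemma \<open>averaged_sum_error\<close>).
  Consequently \<open>xhat\<close> satisfies the integral equation of the averaged
  ODE up to the error \<open>K = \<delta>1 + L \<delta>2 + \<epsilon> (L + 2 \<delta>1)\<close>, whose last summand comes from the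
  incomplete last step.

  If \<open>\<epsilon> \<le> 1\<close>, the deviation at time \<open>n = \<lfloor>1/\<epsilon>\<rfloor>\<close> shows that \<open>abar\<close> is bounded by
  \<open>L + 2 \<delta>1\<close> and Lipschitz with constant \<open>L + 2 \<delta>2\<close> (lemma \<open>average_inherits_bound\<close>), and
  Gronwall's inequality (lemma \<open>gronwall_pseudo_solution\<close>) bounds the distance to the solution by
  \<open>K exp (L + 2 \<delta>2)\<close>. Since \<open>\<delta>1 + \<delta>2 \<le> 1/2\<close> and \<open>L + 1 \<le> exp L\<close>, this is at most
  \<open>e exp (2 L) (\<delta>1 + \<delta>2 + \<epsilon>)\<close>. If \<open>\<epsilon> > 1\<close>, then \<open>xhat\<close> stays at \<open>x0\<close> and the solution moves
  by at most \<open>L\<close>.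
\<close>

section \<open>The maximum norm\<close>

lemma infnorm_le_cart:
  fixes z :: "real ^ 'n"
  assumes "\<And>i. \<bar>z $ i\<bar> \<le> B"
  shows "infnorm z \<le> B"
  unfolding infnorm_cart by (rule cSup_least) (use assms in auto)

lemma infnorm_sum_le:
  fixes f :: "'a \<Rightarrow> 'b::euclidean_space"
  shows "infnorm (sum f A) \<le> (\<Sum>x\<in>A. infnorm (f x))"
proof (induction A rule: infinite_finite_induct)
  case (insert x F)
  then show ?case
    using infnorm_triangle[of "f x" "sum f F"] by simp
qed (simp_all add: infnorm_0)

text \<open>
  The supremum defining \<open>mat_infnorm\<close> is taken over the reals, so it bounds its members only
  because they are bounded; this follows from equivalence with the Euclidean operator norm.
\<close>

lemma infnorm_matrix_vector_mult_le:
  fixes A :: "real ^ 'n ^ 'm" and v :: "real ^ 'n"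
  shows "infnorm (A *v v) \<le> mat_infnorm A * infnorm v"
proof (cases "v = 0")
  case True
  then show ?thesis
    by (simp add: infnorm_0)
next
  case False
  have bdd: "bdd_above (range (\<lambda>v. infnorm (A *v v) / infnorm v))"
  proof (rule bdd_aboveI2)
    fix w :: "real ^ 'n"
    have "infnorm (A *v w) \<le> onorm ((*v) A) * norm w"
      using infnorm_le_norm[of "A *v w"] onorm[OF matrix_vector_mul_bounded_linear, of A w]
      by linarith
    also have "\<dots> \<le> onorm ((*v) A) * (sqrt DIM(real ^ 'n) * infnorm w)"
      by (intro mult_left_mono norm_le_infnorm onorm_pos_le matrix_vector_mul_bounded_linear)
    finally show "infnorm (A *v w) / infnorm w \<le> onorm ((*v) A) * sqrt DIM(real ^ 'n)"
      using infnorm_pos_lt[of w] onorm_pos_le[OF matrix_vector_mul_bounded_linear, of A]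
      by (cases "w = 0") (auto simp: infnorm_0 field_simps)
  qed
  have "infnorm (A *v v) / infnorm v \<le> mat_infnorm A"
    unfolding mat_infnorm_def by (rule cSUP_upper[OF UNIV_I bdd])
  with False show ?thesis
    by (simp add: infnorm_pos_lt pos_divide_le_eq)
qed

text \<open>
  Working one component at a time lets the scalar mean value theorem apply, and the maximum
  over components is the norm itself; so the constant is dimension-free.
\<close>

lemma infnorm_diff_le_jacobian:
  fixes g :: "real ^ 'n \<Rightarrow> real ^ 'm"
  assumes deriv: "\<And>x. (g has_derivative (\<lambda>h. J x *v h)) (at x)"
    and bound: "\<And>x. mat_infnorm (J x) \<le> C"
  shows "infnorm (g x - g y) \<le> C * infnorm (x - y)"
proof (rule infnorm_le_cart)
  fix i
  define p where "p t = y + t *\<^sub>R (x - y)" for t :: real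
  have "((\<lambda>t. g (p t) $ i) has_derivative (\<lambda>t. (J (p s) *v (t *\<^sub>R (x - y))) $ i))
      (at s within {0..1})" for s :: real
  proof -
    have "(p has_derivative (\<lambda>t. t *\<^sub>R (x - y))) (at s within {0..1})"
      unfolding p_def by (auto intro!: derivative_eq_intros)
    from has_derivative_compose[OF this deriv]
    have "((\<lambda>t. g (p t)) has_derivative (\<lambda>t. J (p s) *v (t *\<^sub>R (x - y))))
        (at s within {0..1})" .
    then show ?thesis
      by (rule bounded_linear.has_derivative[OF bounded_linear_vec_nth])
  qed
  then obtain s where "g (p 1) $ i - g (p 0) $ i = (J (p s) *v ((1 - 0) *\<^sub>R (x - y))) $ i"
    using mvt_very_simple[of 0 1 "\<lambda>t. g (p t) $ i"
        "\<lambda>s t. (J (p s) *v (t *\<^sub>R (x - y))) $ i"] by auto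
  then have "(g x - g y) $ i = (J (p s) *v (x - y)) $ i"
    by (simp add: p_def)
  then have "\<bar>(g x - g y) $ i\<bar> \<le> infnorm (J (p s) *v (x - y))"
    using component_le_infnorm_cart[of "J (p s) *v (x - y)" i] by simp
  also have "\<dots> \<le> mat_infnorm (J (p s)) * infnorm (x - y)"
    by (rule infnorm_matrix_vector_mult_le)
  also have "\<dots> \<le> C * infnorm (x - y)"
    by (intro mult_right_mono bound infnorm_pos_le)
  finally show "\<bar>(g x - g y) $ i\<bar> \<le> C * infnorm (x - y)" .
qed

lemma infnorm_has_integral_le:
  fixes f :: "real \<Rightarrow> real ^ 'n"
  assumes f: "(f has_integral z) S" and g: "(g has_integral G) S"
    and le: "\<And>s. s \<in> S \<Longrightarrow> infnorm (f s) \<le> g s"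
  shows "infnorm z \<le> G"
proof (rule infnorm_le_cart)
  fix i
  have fi: "((\<lambda>s. f s $ i) has_integral z $ i) S"
    using has_integral_linear[OF f bounded_linear_vec_nth[of i]] by (simp add: o_def)
  have "norm (integral S (\<lambda>s. f s $ i)) \<le> integral S g"
    using fi g le component_le_infnorm_cart[of "f _" i]
    by (intro integral_norm_bound_integral) (force intro: order_trans)+
  then show "\<bar>z $ i\<bar> \<le> G"
    using fi g by (simp add: integral_unique)
qed

section \<open>Comparison with the averaged flow\<close>

text \<open>
  Gronwall's inequality for a pseudo-solution \<open>x\<close> that may have jumps, so that the usual proof by
  differentiating the integral is not available. Instead the distance is weighted by
  \<open>exp (- \<mu> t)\<close> with \<open>\<mu> > c\<close>: the integral inequality shows that the supremum \<open>m\<close> of the weighted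
  distance is at most a convex combination of \<open>K\<close> and \<open>c m / \<mu>\<close>. As \<open>c m / \<mu> < m\<close> when
  \<open>m > 0\<close>, this forces \<open>m \<le> K\<close>. Letting \<open>\<mu>\<close> decrease to \<open>c\<close> gives the sharp exponent.
\<close>

lemma gronwall_pseudo_solution:
  fixes X x w :: "real \<Rightarrow> real ^ 'n"
  assumes lip: "\<And>u v. infnorm (f u - f v) \<le> c * infnorm (u - v)" and "0 \<le> c" and "0 \<le> K"
    and X: "\<And>t. t \<in> {0..1} \<Longrightarrow> (X has_vector_derivative f (X t)) (at t within {0..1})"
    and w: "\<And>t. t \<in> {0..1} \<Longrightarrow> ((\<lambda>s. f (x s)) has_integral w t) {0..t}"
    and err: "\<And>t. t \<in> {0..1} \<Longrightarrow> infnorm (x t - X 0 - w t) \<le> K"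
    and bdd: "bounded (x ` {0..1})"
    and t: "t \<in> {0..1}"
  shows "infnorm (x t - X t) \<le> K * exp (c * t)"
proof -
  have main: "infnorm (x t - X t) \<le> K * exp (\<mu> * t)" if \<mu>: "c < \<mu>" for \<mu> :: real
  proof -
    from \<mu> \<open>0 \<le> c\<close> have "0 < \<mu>" by simp
    define \<phi> where "\<phi> t = infnorm (x t - X t) * exp (- \<mu> * t)" for t
    define m where "m = (SUP t\<in>{0..1}. \<phi> t)"
    have "continuous_on {0..1} X"
      using X has_vector_derivative_continuous by (force simp: continuous_on_eq_continuous_within)
    then have "bounded (X ` {0..1})"
      by (simp add: compact_continuous_image compact_imp_bounded)
    with bdd obtain B B' where B: "\<forall>t\<in>{0..1}. norm (x t) \<le> B" "\<forall>t\<in>{0..1}. norm (X t) \<le> B'"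
      unfolding bounded_iff by auto
    have "bdd_above (\<phi> ` {0..1})"
    proof (rule bdd_aboveI2)
      fix s :: real assume s: "s \<in> {0..1}"
      have "infnorm (x s - X s) \<le> B + B'"
        using infnorm_le_norm[of "x s - X s"] norm_triangle_ineq4[of "x s" "X s"]
          B[THEN bspec, OF s] by linarith
      moreover have "\<phi> s \<le> infnorm (x s - X s) * 1"
        unfolding \<phi>_def using s \<open>0 < \<mu>\<close> by (intro mult_left_mono) (auto simp: infnorm_pos_le)
      ultimately show "\<phi> s \<le> B + B'" by simp
    qed
    then have \<phi>_le: "\<phi> s \<le> m" if "s \<in> {0..1}" for s
      unfolding m_def using that by (rule cSUP_upper2) auto
    have le_exp: "infnorm (x s - X s) \<le> m * exp (\<mu> * s)" if "s \<in> {0..1}" for s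
      using \<phi>_le[OF that] by (simp add: \<phi>_def exp_minus field_simps)
    have "\<phi> s \<le> max K (c * m / \<mu>)" if s: "s \<in> {0..1}" for s
    proof -
      have "(X has_vector_derivative f (X r)) (at r within {0..s})" if "r \<in> {0..s}" for r
        by (rule has_vector_derivative_within_subset[OF X]) (use s that in auto)
      with s have "((\<lambda>r. f (X r)) has_integral (X s - X 0)) {0..s}"
        by (intro fundamental_theorem_of_calculus) auto
      from has_integral_diff[OF w[OF s] this]
      have 1: "((\<lambda>r. f (x r) - f (X r)) has_integral (w s - (X s - X 0))) {0..s}" .
      have "((\<lambda>r. c * m / \<mu> * exp (\<mu> * r)) has_vector_derivative c * m * exp (\<mu> * r))
          (at r within {0..s})" for r
        using \<open>0 < \<mu>\<close> unfolding has_real_derivative_iff_has_vector_derivative[symmetric]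
        by (auto intro!: derivative_eq_intros)
      with s have 2: "((\<lambda>r. c * m * exp (\<mu> * r)) has_integral
          (c * m / \<mu> * exp (\<mu> * s) - c * m / \<mu> * exp (\<mu> * 0))) {0..s}"
        by (intro fundamental_theorem_of_calculus) auto
      have "infnorm (f (x r) - f (X r)) \<le> c * m * exp (\<mu> * r)" if "r \<in> {0..s}" for r
        using order_trans[OF lip mult_left_mono[OF le_exp \<open>0 \<le> c\<close>]] s that
        by (simp add: mult.assoc)
      from infnorm_has_integral_le[OF 1 2 this]
      have "infnorm (w s - (X s - X 0)) \<le> c * m / \<mu> * (exp (\<mu> * s) - 1)"
        by (simp add: right_diff_distrib)
      then have "infnorm (x s - X s) \<le> K + c * m / \<mu> * (exp (\<mu> * s) - 1)"
        using infnorm_triangle[of "x s - X 0 - w s" "w s - (X s - X 0)"] err[OF s] by simp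
      also have "\<dots> \<le> max K (c * m / \<mu>) + max K (c * m / \<mu>) * (exp (\<mu> * s) - 1)"
        using s \<open>0 < \<mu>\<close> by (intro add_mono mult_right_mono) auto
      finally show ?thesis
        by (simp add: \<phi>_def exp_minus field_simps)
    qed
    then have "m \<le> max K (c * m / \<mu>)"
      unfolding m_def[symmetric] by (subst m_def) (rule cSUP_least, auto)
    moreover have "c * m / \<mu> < m" if "K < m"
      using that \<mu> \<open>0 \<le> K\<close> \<open>0 < \<mu>\<close> by (simp add: divide_less_eq mult.commute)
    ultimately have "m \<le> K" by linarith
    with le_exp[OF t] show ?thesis
      using mult_right_mono[of m K "exp (\<mu> * t)"] by (auto intro: order_trans)
  qed
  have "((\<lambda>\<mu>. K * exp (\<mu> * t)) \<longlongrightarrow> K * exp (c * t)) (at_right c)"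
    by (intro tendsto_intros)
  then show ?thesis
    by (rule tendsto_lowerbound)
       (use main in \<open>auto simp: eventually_at_filter intro!: always_eventually\<close>)
qed

lemma grid_bracket:
  fixes \<epsilon> t :: real
  assumes "0 < \<epsilon>" and "0 \<le> t"
  shows "\<epsilon> * nat \<lfloor>t / \<epsilon>\<rfloor> \<le> t" and "t < \<epsilon> * nat \<lfloor>t / \<epsilon>\<rfloor> + \<epsilon>"
proof -
  have n: "real (nat \<lfloor>t / \<epsilon>\<rfloor>) = of_int \<lfloor>t / \<epsilon>\<rfloor>"
    using assms by simp
  have "\<epsilon> * of_int \<lfloor>t / \<epsilon>\<rfloor> \<le> \<epsilon> * (t / \<epsilon>)" "\<epsilon> * (t / \<epsilon>) < \<epsilon> * (of_int \<lfloor>t / \<epsilon>\<rfloor> + 1)"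
    using assms by (intro mult_left_mono mult_strict_left_mono; linarith)+
  with assms show "\<epsilon> * nat \<lfloor>t / \<epsilon>\<rfloor> \<le> t" and "t < \<epsilon> * nat \<lfloor>t / \<epsilon>\<rfloor> + \<epsilon>"
    unfolding n by (simp_all add: distrib_left)
qed

lemma has_integral_step_function:
  fixes F :: "nat \<Rightarrow> 'b::banach"
  assumes "0 < \<epsilon>" and "0 \<le> t"
  shows "((\<lambda>s. F (nat \<lfloor>s / \<epsilon>\<rfloor>)) has_integral
      (\<epsilon> *\<^sub>R (\<Sum>k<nat \<lfloor>t / \<epsilon>\<rfloor>. F k) + (t - \<epsilon> * nat \<lfloor>t / \<epsilon>\<rfloor>) *\<^sub>R F (nat \<lfloor>t / \<epsilon>\<rfloor>))) {0..t}"
proof -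
  have piece: "((\<lambda>s. F (nat \<lfloor>s / \<epsilon>\<rfloor>)) has_integral ((t - \<epsilon> * n) *\<^sub>R F n)) {\<epsilon> * n..t}"
    if "\<epsilon> * n \<le> t" "t \<le> \<epsilon> * Suc n" for n t
  proof (rule has_integral_spike_finite)
    show "((\<lambda>s. F n) has_integral ((t - \<epsilon> * n) *\<^sub>R F n)) {\<epsilon> * n..t}"
      using has_integral_const_real[of "F n" "\<epsilon> * n" t] that by simp
    show "F (nat \<lfloor>s / \<epsilon>\<rfloor>) = F n" if s: "s \<in> {\<epsilon> * n..t} - {\<epsilon> * Suc n}" for s
    proof -
      have "\<lfloor>s / \<epsilon>\<rfloor> = int n"
        using s \<open>t \<le> \<epsilon> * Suc n\<close> \<open>0 < \<epsilon>\<close> by (intro floor_unique) (auto simp: field_simps)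
      then show ?thesis by simp
    qed
  qed simp
  have grid: "((\<lambda>s. F (nat \<lfloor>s / \<epsilon>\<rfloor>)) has_integral (\<epsilon> *\<^sub>R (\<Sum>k<n. F k))) {0..\<epsilon> * n}" for n
  proof (induction n)
    case (Suc n)
    have "((\<lambda>s. F (nat \<lfloor>s / \<epsilon>\<rfloor>)) has_integral (\<epsilon> *\<^sub>R F n)) {\<epsilon> * n..\<epsilon> * Suc n}"
      using piece[of n "\<epsilon> * Suc n"] \<open>0 < \<epsilon>\<close> by (simp add: algebra_simps)
    with Suc.IH \<open>0 < \<epsilon>\<close> have "((\<lambda>s. F (nat \<lfloor>s / \<epsilon>\<rfloor>)) has_integral
        (\<epsilon> *\<^sub>R (\<Sum>k<n. F k) + \<epsilon> *\<^sub>R F n)) {0..\<epsilon> * Suc n}"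
      by (intro has_integral_combine[of 0 "\<epsilon> * n"]) auto
    then show ?case
      by (simp add: scaleR_add_right)
  qed (simp add: has_integral_refl)
  define n where "n = nat \<lfloor>t / \<epsilon>\<rfloor>"
  have n: "\<epsilon> * n \<le> t" "t \<le> \<epsilon> * Suc n"
    using grid_bracket[OF assms] by (simp_all add: n_def algebra_simps)
  show ?thesis
    unfolding n_def[symmetric]
    using n \<open>0 < \<epsilon>\<close> by (intro has_integral_combine[of 0 "\<epsilon> * n"] grid piece) auto
qed

section \<open>The near-identity change of variables\<close>

text \<open>
  The remainder \<open>r n\<close> in the proof measures how far \<open>x n - u n (x n)\<close> is from the
  Euler scheme for \<open>f\<close> evaluated along \<open>x\<close>. In \<open>r (Suc n) - r n\<close> the
  values of \<open>\<alpha>\<close> and \<open>f\<close> cancel, and only an increment of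
  \<open>u (Suc n)\<close> over one step of \<open>x\<close> is left, which the Lipschitz bound controls.
\<close>

lemma averaged_sum_error:
  fixes x :: "nat \<Rightarrow> real ^ 'n" and \<alpha> :: "nat \<Rightarrow> real ^ 'n \<Rightarrow> real ^ 'n"
    and f :: "real ^ 'n \<Rightarrow> real ^ 'n" and \<epsilon> :: real
  defines "u \<equiv> \<lambda>n z. \<epsilon> *\<^sub>R (\<Sum>j<n. \<alpha> j z - f z)"
  assumes step: "\<And>n. x (Suc n) = x n + \<epsilon> *\<^sub>R \<alpha> n (x n)" and "0 \<le> \<epsilon>" and "0 \<le> \<delta>2"
    and \<alpha>_le: "\<And>n z. infnorm (\<alpha> n z) \<le> L"
    and u_le: "\<And>n z. n \<le> N \<Longrightarrow> infnorm (u n z) \<le> \<delta>1"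
    and u_lip: "\<And>n z z'. n \<le> N \<Longrightarrow> infnorm (u n z - u n z') \<le> \<delta>2 * infnorm (z - z')"
    and "n \<le> N"
  shows "infnorm (x n - x 0 - \<epsilon> *\<^sub>R (\<Sum>k<n. f (x k))) \<le> \<delta>1 + L * \<delta>2 * (\<epsilon> * n)"
proof -
  define r where "r n = x n - x 0 - \<epsilon> *\<^sub>R (\<Sum>k<n. f (x k)) - u n (x n)" for n
  have "infnorm (r n) \<le> L * \<delta>2 * (\<epsilon> * n)" using \<open>n \<le> N\<close>
  proof (induction n)
    case 0
    then show ?case by (simp add: r_def u_def infnorm_0)
  next
    case (Suc n)
    have "r (Suc n) = r n - (u (Suc n) (x (Suc n)) - u (Suc n) (x n))"
      by (simp add: r_def u_def step algebra_simps)
    then have "infnorm (r (Suc n)) \<le> infnorm (r n) + infnorm (u (Suc n) (x (Suc n)) - u (Suc n) (x n))"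
      using infnorm_triangle[of "r n" "- (u (Suc n) (x (Suc n)) - u (Suc n) (x n))"]
      by (simp only: infnorm_neg diff_conv_add_uminus)
    also have "infnorm (u (Suc n) (x (Suc n)) - u (Suc n) (x n)) \<le> \<delta>2 * infnorm (x (Suc n) - x n)"
      by (rule u_lip) fact
    also have "infnorm (x (Suc n) - x n) = \<epsilon> * infnorm (\<alpha> n (x n))"
      using \<open>0 \<le> \<epsilon>\<close> by (simp add: step infnorm_mul)
    also have "\<delta>2 * (\<epsilon> * infnorm (\<alpha> n (x n))) \<le> \<delta>2 * (\<epsilon> * L)"
      by (intro mult_left_mono \<alpha>_le) fact+
    finally show ?case
      using Suc by (simp add: algebra_simps)
  qed
  then show ?thesis
    using infnorm_triangle[of "r n" "u n (x n)"] u_le[OF \<open>n \<le> N\<close>, of "x n"]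
    by (simp add: r_def)
qed

text \<open>
  Over a time \<open>\<epsilon> * N\<close> of at least one half, \<open>w\<close> is the mean of the \<open>v j\<close> up to an error of at
  most \<open>2 * \<eta>\<close>. With \<open>w\<close> a value or a difference of two values of the averaged field, this
  yields its bound and its Lipschitz constant.
\<close>

lemma average_inherits_bound:
  fixes v :: "nat \<Rightarrow> real ^ 'n" and w :: "real ^ 'n"
  assumes "1/2 \<le> \<epsilon> * real N"
    and v: "\<And>j. infnorm (v j) \<le> B" and dev: "infnorm (\<epsilon> *\<^sub>R (\<Sum>j<N. v j - w)) \<le> \<eta>"
  shows "infnorm w \<le> B + 2 * \<eta>"
proof -
  let ?p = "\<epsilon> * real N"
  have "?p * infnorm w = infnorm (?p *\<^sub>R w)"
    using assms(1) by (simp add: infnorm_mul)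
  also have "?p *\<^sub>R w = \<epsilon> *\<^sub>R (\<Sum>j<N. v j) + - (\<epsilon> *\<^sub>R (\<Sum>j<N. v j - w))"
    by (simp add: sum_subtractf sum_constant_scaleR del: sum_constant add: algebra_simps)
  also have "infnorm \<dots> \<le> \<bar>\<epsilon>\<bar> * infnorm (\<Sum>j<N. v j) + \<eta>"
    using infnorm_triangle[of "\<epsilon> *\<^sub>R (\<Sum>j<N. v j)" "- (\<epsilon> *\<^sub>R (\<Sum>j<N. v j - w))"] dev
    by (simp add: infnorm_mul infnorm_neg)
  also have "infnorm (\<Sum>j<N. v j) \<le> N * B"
    using order_trans[OF infnorm_sum_le sum_bounded_above[of "{..<N}" "\<lambda>j. infnorm (v j)" B]] v
    by simp
  also have "\<bar>\<epsilon>\<bar> * (N * B) = ?p * B"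
    using assms(1) zero_less_mult_pos2[of \<epsilon> "real N"] by (cases "N = 0") auto
  finally have "?p * infnorm w \<le> ?p * B + \<eta>"
    by (simp add: mult_left_mono)
  then have "?p * (infnorm w - B) \<le> \<eta>" by (simp add: right_diff_distrib)
  show ?thesis
  proof (cases "infnorm w \<le> B")
    case True
    have "0 \<le> \<eta>" using dev infnorm_pos_le order_trans by blast
    with True show ?thesis by simp
  next
    case False
    then have "1/2 * (infnorm w - B) \<le> ?p * (infnorm w - B)"
      using assms(1) by (intro mult_right_mono) auto
    with \<open>?p * (infnorm w - B) \<le> \<eta>\<close> show ?thesis by simp
  qed
qed

section \<open>Real bounds from the extended norms\<close>

lemma sup_norm_leD:
  assumes "sup_norm \<nu> g \<le> ennreal B" and "0 \<le> B"
  shows "\<nu> (g x) \<le> B"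
proof -
  have "ennreal (\<nu> (g x)) \<le> sup_norm \<nu> g"
    unfolding sup_norm_def by (rule SUP_upper) simp
  with assms show ?thesis
    by (metis ennreal_le_iff order_trans)
qed

lemma lip_norm_on_le_boundD:
  assumes "lip_norm_on S \<nu> g \<le> ennreal B" and "0 \<le> B" and "y \<in> S"
  shows "\<nu> (g x y) \<le> B"
proof (rule sup_norm_leD[of \<nu> "\<lambda>x. g x y"])
  have "lip_norm \<nu> (\<lambda>x. g x y) \<le> lip_norm_on S \<nu> g"
    unfolding lip_norm_on_def using \<open>y \<in> S\<close> by (rule SUP_upper)
  with assms(1) show "sup_norm \<nu> (\<lambda>x. g x y) \<le> ennreal B"
    by (auto simp: lip_norm_def)
qed fact

lemma lip_norm_on_le_lipschitzD:
  fixes g :: "real ^ 'd \<Rightarrow> 'm \<Rightarrow> real ^ 'n"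
  assumes "lip_norm_on S infnorm g \<le> ennreal B" and "0 \<le> B" and "y \<in> S"
  shows "infnorm (g x y - g x' y) \<le> B * infnorm (x - x')"
proof (cases "x = x'")
  case True
  then show ?thesis by (simp add: infnorm_0)
next
  case False
  have "ennreal (infnorm (g x y - g x' y) / infnorm (x - x')) \<le> lip_const infnorm (\<lambda>x. g x y)"
    unfolding lip_const_def using False by (intro SUP_upper2[of "(x, x')"]) auto
  also have "\<dots> \<le> lip_norm infnorm (\<lambda>x. g x y)"
    by (simp add: lip_norm_def)
  also have "\<dots> \<le> lip_norm_on S infnorm g"
    unfolding lip_norm_on_def using \<open>y \<in> S\<close> by (rule SUP_upper)
  also have "\<dots> \<le> ennreal B" by fact
  finally show ?thesis
    using False \<open>0 \<le> B\<close> by (simp add: infnorm_pos_lt pos_divide_le_eq)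
qed

lemma delta1_leD:
  assumes "delta1 a abar T \<epsilon> y0 \<le> ennreal \<eta>" and "0 \<le> \<eta>" and "0 < \<epsilon>" and "real n \<le> 1 / \<epsilon>"
  shows "infnorm (\<epsilon> *\<^sub>R (\<Sum>j<n. a x ((T ^^ j) y0) - abar x)) \<le> \<eta>"
proof (cases "n = 0")
  case True
  then show ?thesis using \<open>0 \<le> \<eta>\<close> by (simp add: infnorm_0)
next
  case False
  then have "ennreal (\<epsilon> * infnorm (\<Sum>j<n. a x ((T ^^ j) y0) - abar x)) \<le> delta1 a abar T \<epsilon> y0"
    unfolding delta1_def using assms by (intro SUP_upper2[of x] SUP_upper2[of n]) auto
  also have "\<dots> \<le> ennreal \<eta>" by fact
  finally show ?thesis
    using \<open>0 \<le> \<eta>\<close> \<open>0 < \<epsilon>\<close> by (simp add: infnorm_mul)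
qed

lemma delta2_leD:
  assumes "delta2 a abar T \<epsilon> y0 \<le> ennreal \<eta>" and "0 \<le> \<eta>" and "0 < \<epsilon>" and "real n \<le> 1 / \<epsilon>"
    and a: "\<And>j x. (\<lambda>x. a x ((T ^^ j) y0)) differentiable at x"
    and abar: "\<And>x. abar differentiable at x"
  shows "infnorm (\<epsilon> *\<^sub>R (\<Sum>j<n. a x ((T ^^ j) y0) - abar x) - \<epsilon> *\<^sub>R (\<Sum>j<n. a x' ((T ^^ j) y0) - abar x'))
    \<le> \<eta> * infnorm (x - x')"
proof (cases "n = 0")
  case True
  then show ?thesis using \<open>0 \<le> \<eta>\<close> by (simp add: infnorm_0 infnorm_pos_le)
next
  case False
  let ?J = "\<lambda>x. \<Sum>j<n. D (\<lambda>x. a x ((T ^^ j) y0)) x - D abar x"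
  let ?g = "\<lambda>x. \<Sum>j<n. a x ((T ^^ j) y0) - abar x"
  have "infnorm (?g x - ?g x') \<le> \<eta> / \<epsilon> * infnorm (x - x')"
  proof (rule infnorm_diff_le_jacobian)
    fix z
    have "(?g has_derivative (\<lambda>h. \<Sum>j<n. D (\<lambda>x. a x ((T ^^ j) y0)) z *v h - D abar z *v h)) (at z)"
      unfolding D_def by (intro has_derivative_sum has_derivative_diff)
        (use a abar in \<open>simp_all add: jacobian_works\<close>)
    moreover have "(\<Sum>j<n. D (\<lambda>x. a x ((T ^^ j) y0)) z *v h - D abar z *v h) = ?J z *v h" for h
      by (induction n) (simp_all add: algebra_simps)
    ultimately show "(?g has_derivative (\<lambda>h. ?J z *v h)) (at z)" by simp
    have "ennreal (\<epsilon> * mat_infnorm (?J z)) \<le> delta2 a abar T \<epsilon> y0"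
      unfolding delta2_def using assms False by (intro SUP_upper2[of z] SUP_upper2[of n]) auto
    also have "\<dots> \<le> ennreal \<eta>" by fact
    finally show "mat_infnorm (?J z) \<le> \<eta> / \<epsilon>"
      using \<open>0 \<le> \<eta>\<close> \<open>0 < \<epsilon>\<close> by (simp add: field_simps)
  qed
  then have "\<epsilon> * infnorm (?g x - ?g x') \<le> \<eta> * infnorm (x - x')"
    using \<open>0 < \<epsilon>\<close> by (simp add: field_simps)
  then show ?thesis
    using \<open>0 < \<epsilon>\<close> unfolding scaleR_diff_right[symmetric] infnorm_mul by simp
qed

section \<open>The averaging estimate\<close>

text \<open>
  The factor \<open>exp (2 * L)\<close> splits into one \<open>exp L\<close> that absorbs the polynomial prefactor
  \<open>1 + L\<close> and one from the Gronwall exponent, which exceeds \<open>L\<close> by at most \<open>1\<close>;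
  the excess costs a factor \<open>exp 1 \<le> 5\<close>.
\<close>

lemma averaging_constant:
  fixes L \<epsilon> \<delta>1 \<delta>2 t :: real
  assumes "1 \<le> L" "0 \<le> \<epsilon>" "0 \<le> \<delta>1" "0 \<le> \<delta>2" "\<delta>1 + \<delta>2 \<le> 1/2" "t \<in> {0..1}"
  shows "(\<delta>1 + L * \<delta>2 + \<epsilon> * (L + 2 * \<delta>1)) * exp ((L + 2 * \<delta>2) * t)
    \<le> 5 * exp (2 * L) * (\<delta>1 + \<delta>2 + \<epsilon>)"
proof -
  have "0 \<le> L * \<delta>1" "\<epsilon> * (2 * \<delta>1) \<le> \<epsilon>"
    using assms mult_left_le[of "2 * \<delta>1" \<epsilon>] by auto
  moreover have "(1 + L) * (\<delta>1 + \<delta>2 + \<epsilon>) - (\<delta>1 + L * \<delta>2 + \<epsilon> * (L + 2 * \<delta>1))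
      = \<delta>2 + L * \<delta>1 + (\<epsilon> - \<epsilon> * (2 * \<delta>1))"
    by (simp add: algebra_simps)
  ultimately have "\<delta>1 + L * \<delta>2 + \<epsilon> * (L + 2 * \<delta>1) \<le> (1 + L) * (\<delta>1 + \<delta>2 + \<epsilon>)"
    using \<open>0 \<le> \<delta>2\<close> by linarith
  also have "\<dots> \<le> exp L * (\<delta>1 + \<delta>2 + \<epsilon>)"
    using assms by (intro mult_right_mono exp_ge_add_one_self) auto
  finally have K: "\<delta>1 + L * \<delta>2 + \<epsilon> * (L + 2 * \<delta>1) \<le> exp L * (\<delta>1 + \<delta>2 + \<epsilon>)" .
  have "(L + 2 * \<delta>2) * t \<le> L + 1"
    using mult_left_le[of t "L + 2 * \<delta>2"] assms unfolding atLeastAtMost_iff by linarith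
  then have "exp ((L + 2 * \<delta>2) * t) \<le> exp L * exp 1"
    by (simp add: exp_add[symmetric])
  also have "\<dots> \<le> exp L * 5"
    using exp_le by (intro mult_left_mono) auto
  finally have "(\<delta>1 + L * \<delta>2 + \<epsilon> * (L + 2 * \<delta>1)) * exp ((L + 2 * \<delta>2) * t)
      \<le> (exp L * (\<delta>1 + \<delta>2 + \<epsilon>)) * (exp L * 5)"
    using K assms by (intro mult_mono) auto
  also have "\<dots> = 5 * exp (2 * L) * (\<delta>1 + \<delta>2 + \<epsilon>)"
    by (simp add: exp_double power2_eq_square)
  finally show ?thesis .
qed

lemma averaging_estimate:
  fixes a :: "real ^ 'd \<Rightarrow> 'm \<Rightarrow> real ^ 'd" and X :: "real \<Rightarrow> real ^ 'd"
  assumes "1 \<le> L" and "0 < \<epsilon>" and "\<epsilon> \<le> 1"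
    and "0 \<le> \<delta>1" and "0 \<le> \<delta>2" and "\<delta>1 + \<delta>2 \<le> 1/2"
    and a_le: "\<And>n z. infnorm (a z ((T ^^ n) y0)) \<le> L"
    and a_lip: "\<And>n z z'. infnorm (a z ((T ^^ n) y0) - a z' ((T ^^ n) y0)) \<le> L * infnorm (z - z')"
    and u_le: "\<And>n z. real n \<le> 1 / \<epsilon> \<Longrightarrow>
      infnorm (\<epsilon> *\<^sub>R (\<Sum>j<n. a z ((T ^^ j) y0) - abar z)) \<le> \<delta>1"
    and u_lip: "\<And>n z z'. real n \<le> 1 / \<epsilon> \<Longrightarrow>
      infnorm (\<epsilon> *\<^sub>R (\<Sum>j<n. a z ((T ^^ j) y0) - abar z) - \<epsilon> *\<^sub>R (\<Sum>j<n. a z' ((T ^^ j) y0) - abar z'))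
        \<le> \<delta>2 * infnorm (z - z')"
    and X: "\<And>t. t \<in> {0..1} \<Longrightarrow> (X has_vector_derivative abar (X t)) (at t within {0..1})"
    and X0: "X 0 = x0"
    and t: "t \<in> {0..1}"
  shows "infnorm (xhat a T \<epsilon> x0 y0 t - X t) \<le> 5 * exp (2 * L) * (\<delta>1 + \<delta>2 + \<epsilon>)"
proof -
  define x where "x = slow a T \<epsilon> x0 y0"
  define N where "N = nat \<lfloor>1 / \<epsilon>\<rfloor>"
  have N: "1 \<le> real N" "real N \<le> 1 / \<epsilon>" "1 / \<epsilon> < real N + 1"
    using \<open>0 < \<epsilon>\<close> \<open>\<epsilon> \<le> 1\<close> floor_correct[of "1 / \<epsilon>"]
    by (auto simp: N_def le_nat_iff le_floor_iff)
  have "1 < \<epsilon> * (real N + 1)"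
    using N \<open>0 < \<epsilon>\<close> by (simp add: field_simps)
  moreover have "\<epsilon> * 1 \<le> \<epsilon> * real N"
    using N \<open>0 < \<epsilon>\<close> by (intro mult_left_mono) auto
  ultimately have half: "1/2 \<le> \<epsilon> * real N"
    by (simp add: algebra_simps)

  \<comment> \<open>Since \<open>N \<ge> 1\<close>, rounding \<open>1 / \<epsilon>\<close> down to \<open>N\<close> loses at most half of the total time.\<close>
  have abar_le: "infnorm (abar z) \<le> L + 2 * \<delta>1" for z
    using average_inherits_bound[OF half a_le u_le[OF N(2)]] .
  have abar_lip: "infnorm (abar z - abar z') \<le> (L + 2 * \<delta>2) * infnorm (z - z')" for z z'
  proof -
    have "\<epsilon> *\<^sub>R (\<Sum>j<N. (a z ((T ^^ j) y0) - a z' ((T ^^ j) y0)) - (abar z - abar z'))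
      = \<epsilon> *\<^sub>R (\<Sum>j<N. a z ((T ^^ j) y0) - abar z) - \<epsilon> *\<^sub>R (\<Sum>j<N. a z' ((T ^^ j) y0) - abar z')"
      by (simp add: scaleR_diff_right[symmetric] sum_subtractf[symmetric] algebra_simps)
    then have "infnorm (abar z - abar z') \<le> L * infnorm (z - z') + 2 * (\<delta>2 * infnorm (z - z'))"
      using u_lip[OF N(2), of z z'] a_lip
      by (intro average_inherits_bound[OF half, where v = "\<lambda>j. a z ((T ^^ j) y0) - a z' ((T ^^ j) y0)"])
        simp_all
    then show ?thesis by (simp add: algebra_simps)
  qed

  define w where "w t = \<epsilon> *\<^sub>R (\<Sum>k<nat \<lfloor>t / \<epsilon>\<rfloor>. abar (x k))
    + (t - \<epsilon> * nat \<lfloor>t / \<epsilon>\<rfloor>) *\<^sub>R abar (x (nat \<lfloor>t / \<epsilon>\<rfloor>))" for t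
  have err: "infnorm (x (nat \<lfloor>t / \<epsilon>\<rfloor>) - X 0 - w t) \<le> \<delta>1 + L * \<delta>2 + \<epsilon> * (L + 2 * \<delta>1)"
    if t: "t \<in> {0..1}" for t
  proof -
    define n where "n = nat \<lfloor>t / \<epsilon>\<rfloor>"
    have n: "\<epsilon> * n \<le> t" "t \<le> \<epsilon> * n + \<epsilon>"
      using grid_bracket[of \<epsilon> t] t \<open>0 < \<epsilon>\<close> by (simp_all add: n_def)
    have "n \<le> N"
      unfolding n_def N_def using t \<open>0 < \<epsilon>\<close>
      by (intro nat_mono floor_mono divide_right_mono) auto
    have le_N: "real k \<le> 1 / \<epsilon>" if "k \<le> N" for k
      using that N(2) by (meson of_nat_le_iff order_trans)
    have "infnorm (x n - x 0 - \<epsilon> *\<^sub>R (\<Sum>k<n. abar (x k))) \<le> \<delta>1 + L * \<delta>2 * (\<epsilon> * n)"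
      using assms \<open>n \<le> N\<close> le_N
      by (intro averaged_sum_error[where \<alpha> = "\<lambda>n z. a z ((T ^^ n) y0)" and N = N])
        (auto simp: x_def)
    also have "\<dots> \<le> \<delta>1 + L * \<delta>2 * 1"
      using n t assms by (intro add_left_mono mult_left_mono) auto
    finally have "infnorm (x n - X 0 - \<epsilon> *\<^sub>R (\<Sum>k<n. abar (x k))) \<le> \<delta>1 + L * \<delta>2"
      by (simp add: x_def X0)
    moreover have "infnorm ((t - \<epsilon> * n) *\<^sub>R abar (x n)) \<le> \<epsilon> * (L + 2 * \<delta>1)"
      unfolding infnorm_mul using n abar_le infnorm_pos_le \<open>0 < \<epsilon>\<close> by (intro mult_mono) auto
    ultimately show ?thesis
      using infnorm_triangle[of "x n - X 0 - \<epsilon> *\<^sub>R (\<Sum>k<n. abar (x k))"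
          "- ((t - \<epsilon> * n) *\<^sub>R abar (x n))"]
      unfolding w_def n_def[symmetric] infnorm_neg by (simp add: algebra_simps)
  qed
  have bdd: "bounded ((\<lambda>s. x (nat \<lfloor>s / \<epsilon>\<rfloor>)) ` {0..1})"
  proof (rule bounded_subset)
    show "bounded (x ` {..N})" by (simp add: finite_imp_bounded)
    show "(\<lambda>s. x (nat \<lfloor>s / \<epsilon>\<rfloor>)) ` {0..1} \<subseteq> x ` {..N}"
      unfolding N_def using \<open>0 < \<epsilon>\<close>
      by (auto intro!: imageI nat_mono floor_mono divide_right_mono)
  qed
  have "infnorm (x (nat \<lfloor>t / \<epsilon>\<rfloor>) - X t)
      \<le> (\<delta>1 + L * \<delta>2 + \<epsilon> * (L + 2 * \<delta>1)) * exp ((L + 2 * \<delta>2) * t)"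
  proof (rule gronwall_pseudo_solution[OF abar_lip _ _ X _ err bdd t])
    show "((\<lambda>s. abar (x (nat \<lfloor>s / \<epsilon>\<rfloor>))) has_integral w t) {0..t}" if "t \<in> {0..1}" for t
      unfolding w_def using that \<open>0 < \<epsilon>\<close>
      by (intro has_integral_step_function[where F = "\<lambda>k. abar (x k)"]) auto
  qed (use assms in auto)
  also have "\<dots> \<le> 5 * exp (2 * L) * (\<delta>1 + \<delta>2 + \<epsilon>)"
    using assms by (intro averaging_constant) auto
  finally show ?thesis
    by (simp add: xhat_def x_def)
qed

theorem theoremA1:
  fixes M :: "'m measure"
    and T :: "'m \<Rightarrow> 'm"
    and a :: "real ^ 'd \<Rightarrow> 'm \<Rightarrow> real ^ 'd"
    and abar :: "real ^ 'd \<Rightarrow> real ^ 'd"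
    and L \<epsilon> :: real
    and x0 :: "real ^ 'd"
    and X :: "real \<Rightarrow> real ^ 'd"
  assumes "T \<in> M \<rightarrow>\<^sub>M M"
    and "L \<ge> 1"
    and "\<And>x y. y \<in> space M \<Longrightarrow> (\<lambda>x. a x y) differentiable at x"
    and "\<And>x. abar differentiable at x"
    and "lip_norm_on (space M) infnorm a \<le> ennreal L"
    and "lip_norm_on (space M) mat_infnorm (\<lambda>x y. D (\<lambda>x. a x y) x) \<le> ennreal L"
    and "\<epsilon> > 0"
    and "\<epsilon> > 1 \<Longrightarrow> sup_norm infnorm abar \<le> ennreal L"
    and "X 0 = x0"
    and "\<And>t. t \<in> {0..1} \<Longrightarrow> (X has_vector_derivative abar (X t)) (at t within {0..1})"
  shows "\<forall>y0 \<in> space M. delta a abar T \<epsilon> y0 \<le> ennreal (1 / 2) \<longrightarrow>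
           (\<forall>t \<in> {0..1}. ennreal (infnorm (xhat a T \<epsilon> x0 y0 t - X t))
              \<le> ennreal (5 * exp (2 * L)) * (delta a abar T \<epsilon> y0 + ennreal \<epsilon>))"
proof (intro ballI impI)
  fix y0 t
  assume y0: "y0 \<in> space M" and \<delta>: "delta a abar T \<epsilon> y0 \<le> ennreal (1 / 2)"
    and t: "t \<in> {0..(1::real)}"
  have orbit: "(T ^^ n) y0 \<in> space M" for n
    by (induction n) (use y0 assms(1) in \<open>auto simp: measurable_def\<close>)
  have "delta1 a abar T \<epsilon> y0 < top" "delta2 a abar T \<epsilon> y0 < top"
    using le_less_trans[OF \<delta> ennreal_less_top] by (simp_all add: delta_def)
  then obtain \<delta>1 \<delta>2 where \<delta>1: "delta1 a abar T \<epsilon> y0 = ennreal \<delta>1" "0 \<le> \<delta>1"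
    and \<delta>2: "delta2 a abar T \<epsilon> y0 = ennreal \<delta>2" "0 \<le> \<delta>2"
    by (metis enn2real_nonneg ennreal_enn2real)
  then have \<delta>_eq: "delta a abar T \<epsilon> y0 = ennreal (\<delta>1 + \<delta>2)"
    by (simp add: delta_def)
  have "\<delta>1 + \<delta>2 \<le> 1/2"
    using \<delta> unfolding \<delta>_eq by (subst (asm) ennreal_le_iff) auto
  have "infnorm (xhat a T \<epsilon> x0 y0 t - X t) \<le> 5 * exp (2 * L) * (\<delta>1 + \<delta>2 + \<epsilon>)"
  proof (cases "\<epsilon> \<le> 1")
    case True
    show ?thesis
    proof (rule averaging_estimate)
      show "infnorm (a z ((T ^^ n) y0)) \<le> L" for n z
        using lip_norm_on_le_boundD[OF assms(5) _ orbit] assms(2) by simp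
      show "infnorm (a z ((T ^^ n) y0) - a z' ((T ^^ n) y0)) \<le> L * infnorm (z - z')" for n z z'
        using lip_norm_on_le_lipschitzD[OF assms(5) _ orbit] assms(2) by simp
      show "infnorm (\<epsilon> *\<^sub>R (\<Sum>j<n. a z ((T ^^ j) y0) - abar z)) \<le> \<delta>1"
        if "real n \<le> 1 / \<epsilon>" for n z
        using delta1_leD \<delta>1 \<open>0 < \<epsilon>\<close> that by (metis order_refl)
      show "infnorm (\<epsilon> *\<^sub>R (\<Sum>j<n. a z ((T ^^ j) y0) - abar z)
          - \<epsilon> *\<^sub>R (\<Sum>j<n. a z' ((T ^^ j) y0) - abar z')) \<le> \<delta>2 * infnorm (z - z')"
        if "real n \<le> 1 / \<epsilon>" for n z z'
        by (rule delta2_leD) (use \<delta>2 \<open>0 < \<epsilon>\<close> that assms(3,4) orbit in auto)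
    qed (use assms True t \<delta>1 \<delta>2 \<open>\<delta>1 + \<delta>2 \<le> 1/2\<close> in auto)
  next
    case False
    \<comment> \<open>No step is completed by time one, so it suffices to bound the displacement of \<open>X\<close>.\<close>
    then have "0 \<le> t / \<epsilon>" "t / \<epsilon> < 1" using t by auto
    then have "\<lfloor>t / \<epsilon>\<rfloor> = 0" by (simp add: floor_eq_iff)
    then have xhat: "xhat a T \<epsilon> x0 y0 t = x0" by (simp add: xhat_def)
    have "(X has_vector_derivative abar (X s)) (at s within {0..t})" if "s \<in> {0..t}" for s
      by (rule has_vector_derivative_within_subset[OF assms(10)]) (use t that in auto)
    with t have "((\<lambda>s. abar (X s)) has_integral (X t - X 0)) {0..t}"
      by (intro fundamental_theorem_of_calculus) auto
    moreover have "((\<lambda>s. L) has_integral (L * t)) {0..t}"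
      using has_integral_const_real[of L 0 t] t by (simp add: mult.commute)
    moreover have "infnorm (abar (X s)) \<le> L" for s
      using sup_norm_leD[OF assms(8)] False assms(2) by simp
    ultimately have "infnorm (X t - X 0) \<le> L * t"
      by (rule infnorm_has_integral_le)
    also have "\<dots> \<le> L * 1"
      using t assms(2) by (intro mult_left_mono) auto
    also have "\<dots> \<le> 5 * exp (2 * L) * 1"
      using exp_ge_add_one_self[of "2 * L"] assms(2) by linarith
    also have "\<dots> \<le> 5 * exp (2 * L) * (\<delta>1 + \<delta>2 + \<epsilon>)"
      using False \<delta>1 \<delta>2 by (intro mult_left_mono) auto
    finally show ?thesis
      by (simp add: xhat assms(9) infnorm_sub)
  qed
  then show "ennreal (infnorm (xhat a T \<epsilon> x0 y0 t - X t))
      \<le> ennreal (5 * exp (2 * L)) * (delta a abar T \<epsilon> y0 + ennreal \<epsilon>)"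
    using \<delta>1 \<delta>2 \<open>0 < \<epsilon>\<close>
    by (simp add: \<delta>_eq ennreal_plus[symmetric] ennreal_mult[symmetric] del: ennreal_plus)
qed

end
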